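(* Let $T$ and $d$ be integers with $1\le d\le T$, and let $X=\{x\in\mathbb{R}^d:\|x\|_2\le 1\}$ be the Euclidean unit ball. There exist a convex $1$-Lipschitz function $f:X\to\mathbb{R}$ and a (deterministic) sub-gradient oracle for $f$ such that the iterates of projected sub-gradient descent on $f$ with this oracle, initial point $x_1=0$ and fixed step sizes $\eta_t=1/\sqrt{T}$, i.e. $x_{t+1}=\Pi_X(x_t-\eta_t\hat g_t)$ with $\hat g_t\in\partial f(x_t)$ the vector returned by the oracle at step $t$ ($t=1,\dots,T$), satisfy $$f(x_{T+1})-\min_{x\in X}f(x)\ \ge\ \frac{\log d}{32\sqrt{T}}.$$
   Context: $\Pi_X$ denotes Euclidean projection onto $X$. For a convex function $f:X\to\mathbb{R}$ and $x\in X$, $\partial f(x)$ is the set of $g\in\mathbb{R}^d$ with $f(x')-f(x)\ge g^\top(x'-x)$ for all $x'\in X$. $f$ is $L$-Lipschitz if $|f(x)-f(y)|\le L\|x-y\|_2$ for all $x,y\in X$. A deterministic sub-gradient oracle returns, at each step $t$, some element of $\partial f(x_t)$ at the current iterate $x_t$; the choice may depend on the step index $t$ as well as on $x_t$. $\log$ is the natural logarithm. *)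

theory Defs
  imports "HOL-Analysis.Analysis"
begin

text \<open>Subgradients are tested only against points of \<open>X\<close>, so \<open>subdifferential X f x\<close> depends on
  \<open>f\<close> only through its restriction to \<open>X\<close> (when \<open>x \<in> X\<close>).\<close>

definition subdifferential :: "'a::euclidean_space set \<Rightarrow> ('a \<Rightarrow> real) \<Rightarrow> 'a \<Rightarrow> 'a set" where
  "subdifferential X f x = {g. \<forall>x'\<in>X. f x' - f x \<ge> g \<bullet> (x' - x)}"

text \<open>A deterministic oracle is a function of the step index and the current point. It is required
  to answer correctly at every point of \<open>X\<close> and every step, not only along one trajectory.\<close>

definition subgradient_oracle ::
    "'a::euclidean_space set \<Rightarrow> ('a \<Rightarrow> real) \<Rightarrow> (nat \<Rightarrow> 'a \<Rightarrow> 'a) \<Rightarrow> bool" where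
  "subgradient_oracle X f G \<longleftrightarrow> (\<forall>t\<ge>1. \<forall>x\<in>X. G t x \<in> subdifferential X f x)"

text \<open>Iterates are numbered from 1: \<open>psgd X \<eta> G x\<^sub>1 t\<close> is \<open>x\<^sub>t\<close> for \<open>t \<ge> 1\<close>.
  The value at index 0 is a dummy.\<close>

primrec psgd ::
    "'a::euclidean_space set \<Rightarrow> (nat \<Rightarrow> real) \<Rightarrow> (nat \<Rightarrow> 'a \<Rightarrow> 'a) \<Rightarrow> 'a \<Rightarrow> nat \<Rightarrow> 'a" where
  "psgd X \<eta> G x\<^sub>1 0 = x\<^sub>1"
| "psgd X \<eta> G x\<^sub>1 (Suc t) =
    (if t = 0 then x\<^sub>1
     else closest_point X (psgd X \<eta> G x\<^sub>1 t - \<eta> t *\<^sub>R G t (psgd X \<eta> G x\<^sub>1 t)))"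

end

theory Submission
  imports Defs
begin

text \<open>The function is \<open>f x = max\<^sub>i h\<^sub>i \<bullet> x\<close> over \<open>i = 0, \<dots>, d + 1\<close>, where \<open>h\<^sub>i\<close> has entry
  \<open>- 1/2\<close> at position \<open>i\<close> and entries \<open>1 / (4 (d + 1 - p))\<close> at the positions \<open>p < i\<close>. As \<open>h\<^sub>0 = 0\<close>, the
  minimum of \<open>f\<close> is \<open>f 0 = 0\<close>. Answering \<open>h\<^sub>0\<close> during the first \<open>T - d\<close> steps keeps
  the iterate at the origin; afterwards the answers are \<open>h\<^sub>1, \<dots>, h\<^sub>d\<close>. Each of these answers opens one
  coordinate by \<open>\<eta> / 2\<close>, of which the later answers take back at most \<open>\<eta> / 4\<close>. Hence the iterates
  are nonnegative, which makes the next \<open>h\<^sub>i\<close> active, and they are so small that the projection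
  never acts. All coordinates of the last iterate are at least \<open>\<eta> / 4\<close>, and its inner product with
  \<open>h\<^bsub>d+1\<^esub>\<close> is at least \<open>\<eta> / 16\<close> times the \<open>d\<close>-th harmonic number.\<close>

section \<open>Maxima of finitely many linear functions\<close>

definition max_linear :: "'i set \<Rightarrow> ('i \<Rightarrow> 'a::euclidean_space) \<Rightarrow> 'a \<Rightarrow> real" where
  "max_linear I h x = Max ((\<lambda>i. h i \<bullet> x) ` I)"

lemma max_linear_ge:
  assumes "finite I" "i \<in> I"
  shows "h i \<bullet> x \<le> max_linear I h x"
  unfolding max_linear_def using assms by (intro Max_ge) auto

lemma max_linear_attained:
  assumes "finite I" "I \<noteq> {}"
  obtains i where "i \<in> I" "max_linear I h x = h i \<bullet> x"
proof -
  have "max_linear I h x \<in> (\<lambda>i. h i \<bullet> x) ` I"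
    unfolding max_linear_def using assms by (intro Max_in) auto
  then show ?thesis using that by blast
qed

lemma max_linear_eqI:
  assumes "finite I" "i \<in> I" "\<And>j. j \<in> I \<Longrightarrow> h j \<bullet> x \<le> h i \<bullet> x"
  shows "max_linear I h x = h i \<bullet> x"
  unfolding max_linear_def using assms by (intro Max_eqI) auto

lemma convex_on_max_linear:
  assumes "finite I" "I \<noteq> {}" "convex X"
  shows "convex_on X (max_linear I h)"
proof (rule convex_onI)
  fix t :: real and x y assume t: "0 < t" "t < 1"
  obtain i where i: "i \<in> I"
    and eq: "max_linear I h ((1 - t) *\<^sub>R x + t *\<^sub>R y) = h i \<bullet> ((1 - t) *\<^sub>R x + t *\<^sub>R y)"
    using max_linear_attained[OF assms(1,2)] .
  show "max_linear I h ((1 - t) *\<^sub>R x + t *\<^sub>R y)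
      \<le> (1 - t) * max_linear I h x + t * max_linear I h y"
    unfolding eq inner_add_right inner_scaleR_right
    using t max_linear_ge[OF assms(1) i] by (intro add_mono mult_left_mono) auto
qed (fact assms(3))

lemma lipschitz_on_max_linear:
  assumes "finite I" "I \<noteq> {}" "0 \<le> L" "\<And>i. i \<in> I \<Longrightarrow> norm (h i) \<le> L"
  shows "L-lipschitz_on X (max_linear I h)"
proof (rule lipschitz_onI)
  have *: "max_linear I h x - max_linear I h y \<le> L * dist x y" for x y
  proof -
    obtain i where i: "i \<in> I" and eq: "max_linear I h x = h i \<bullet> x"
      using max_linear_attained[OF assms(1,2)] .
    have "max_linear I h x - max_linear I h y \<le> h i \<bullet> (x - y)"
      using max_linear_ge[OF assms(1) i, of h y] by (simp add: eq inner_diff_right)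
    also have "\<dots> \<le> norm (h i) * norm (x - y)" by (rule norm_cauchy_schwarz)
    also have "\<dots> \<le> L * dist x y"
      unfolding dist_norm using assms(4)[OF i] by (rule mult_right_mono) simp
    finally show ?thesis .
  qed
  fix x y
  show "dist (max_linear I h x) (max_linear I h y) \<le> L * dist x y"
    using *[of x y] *[of y x] by (simp add: dist_real_def dist_commute abs_le_iff)
qed (fact assms(3))

text \<open>The piece \<open>h i\<close> touches the maximum at \<open>x\<close> and lies below it
  everywhere.\<close>

lemma subdifferential_max_linear:
  assumes "finite I" "i \<in> I" "max_linear I h x = h i \<bullet> x"
  shows "h i \<in> subdifferential X (max_linear I h) x"
  using max_linear_ge[OF assms(1,2)] assms(3)
  by (auto simp: subdifferential_def inner_diff_right)

lemma sum_inverse_squares_le: "(\<Sum>k=1..n. 1 / (real k)\<^sup>2) \<le> 2"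
proof -
  \<comment> \<open>The subtracted term lets the induction telescope, via
    \<open>1 / k^2 \<le> 1 / (k - 1) - 1 / k\<close>.\<close>
  have "(\<Sum>k=1..Suc n. 1 / (real k)\<^sup>2) \<le> 2 - 1 / real (Suc n)" for n
  proof (induction n)
    case (Suc n)
    have "1 / (real (Suc (Suc n)))\<^sup>2 \<le> 1 / (real (Suc n) * real (Suc (Suc n)))"
      by (intro divide_left_mono) (auto simp: power2_eq_square)
    also have "\<dots> = 1 / real (Suc n) - 1 / real (Suc (Suc n))"
      by (simp add: divide_simps)
    finally show ?case using Suc.IH by simp
  qed simp
  from this[of "n - 1"] show ?thesis
    by (cases n) (auto intro: order_trans)
qed

text \<open>The type \<open>'n\<close> carries no order, so \<open>r\<close> numbers the
  coordinates. By \<open>step_small\<close>, vectors with all entries in \<open>[0, \<eta>]\<close>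
  stay in the unit ball.\<close>

locale slow_last_iterate =
  fixes r :: "'n::finite \<Rightarrow> nat" and \<eta> :: real
  assumes bij: "bij_betw r UNIV {1..CARD('n)}"
    and step_nonneg: "0 \<le> \<eta>"
    and step_small: "real CARD('n) * \<eta>\<^sup>2 \<le> 1"
begin

definition pieces :: "nat set" where
  "pieces = {..Suc CARD('n)}"

text \<open>Only \<open>CARD('n) - r j\<close> answers follow the opening of coordinate
  \<open>j\<close>, fewer than this weight. At \<open>\<eta> / (4 * weight j)\<close> each, they
  take back less than \<open>\<eta> / 4\<close> if \<open>\<eta>\<close> is positive.\<close>

definition weight :: "'n \<Rightarrow> nat" where
  "weight j = Suc CARD('n) - r j"

definition slope :: "nat \<Rightarrow> real ^ 'n" where
  "slope i = (\<chi> j. if r j < i then 1 / (4 * real (weight j))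
                  else if r j = i then - 1 / 2 else 0)"

abbreviation objective :: "real ^ 'n \<Rightarrow> real" where
  "objective \<equiv> max_linear pieces slope"

text \<open>Closed form of the trajectory when piece \<open>k\<close> is about to be answered:
  \<open>k - Suc (r j)\<close> counts the answers since coordinate \<open>j\<close> was
  opened.\<close>

definition iterate :: "nat \<Rightarrow> real ^ 'n" where
  "iterate k = (\<chi> j. if r j < k
     then \<eta> * (1 / 2 - real (k - Suc (r j)) / (4 * real (weight j))) else 0)"

definition active :: "real ^ 'n \<Rightarrow> nat \<Rightarrow> bool" where
  "active x i \<longleftrightarrow> i \<in> pieces \<and> objective x = slope i \<bullet> x"

text \<open>Truncated subtraction selects piece 0 during the first \<open>m\<close> steps. Points
  off the trajectory need valid answers too, hence the fallback to any active piece.\<close>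

definition answer :: "nat \<Rightarrow> nat \<Rightarrow> real ^ 'n \<Rightarrow> real ^ 'n" where
  "answer m t x = slope (if active x (t - m) then t - m else SOME i. active x i)"

section \<open>Bounds on slopes and iterates\<close>

lemma finite_pieces: "finite pieces" and pieces_nonempty: "pieces \<noteq> {}"
  by (auto simp: pieces_def)

lemma r_range: "1 \<le> r j" "r j \<le> CARD('n)"
  using bij_betw_apply[OF bij, of j] by auto

lemma weight_pos: "0 < weight j"
  using r_range[of j] by (simp add: weight_def)

lemma sum_r: "(\<Sum>j\<in>UNIV. g (r j)) = (\<Sum>p=1..CARD('n). g p)" for g :: "nat \<Rightarrow> real"
  by (rule sum.reindex_bij_betw[OF bij])

lemma sum_weight: "(\<Sum>j\<in>UNIV. g (weight j)) = (\<Sum>q=1..CARD('n). g q)" for g :: "nat \<Rightarrow> real"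
  unfolding weight_def sum_r[of "\<lambda>p. g (Suc CARD('n) - p)"]
  by (rule sum.reindex_bij_witness[of _ "\<lambda>q. Suc CARD('n) - q" "\<lambda>q. Suc CARD('n) - q"]) auto

lemma slope_0: "slope 0 = 0"
  using r_range(1) by (simp add: slope_def vec_eq_iff Suc_le_eq)

lemma norm_slope: "norm (slope i) \<le> 1"
proof -
  have "(norm (slope i))\<^sup>2 = (\<Sum>j\<in>UNIV. (slope i $ j)\<^sup>2)"
    by (simp add: norm_vec_def L2_set_def sum_nonneg)
  \<comment> \<open>The inverse-square term is added at every position, so that the weights run
    through all of \<open>{1..CARD('n)}\<close>.\<close>
  also have "\<dots> \<le> (\<Sum>j\<in>UNIV. (if r j = i then 1 / 4 else 0) + 1 / (real (weight j))\<^sup>2 / 16)"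
    by (intro sum_mono) (auto simp: slope_def power_divide power_mult_distrib)
  also have "\<dots> = (\<Sum>p=1..CARD('n). if p = i then 1 / 4 else 0)
      + (\<Sum>q=1..CARD('n). 1 / (real q)\<^sup>2) / 16"
    unfolding sum.distrib sum_divide_distrib[symmetric]
      sum_r[of "\<lambda>p. if p = i then 1 / 4 else 0"] sum_weight[of "\<lambda>q. 1 / (real q)\<^sup>2"] ..
  also have "\<dots> \<le> 1 / 4 + 2 / 16"
    by (intro add_mono divide_right_mono sum_inverse_squares_le) auto
  finally have "(norm (slope i))\<^sup>2 \<le> 1\<^sup>2" by simp
  then show ?thesis by (rule power2_le_imp_le) simp
qed

lemma iterate_0: "iterate 0 = 0"
  by (simp add: iterate_def vec_eq_iff)

lemma iterate_Suc: "iterate (Suc k) = iterate k - \<eta> *\<^sub>R slope k"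
proof -
  have "iterate (Suc k) $ j = iterate k $ j - \<eta> * slope k $ j" for j
  proof (cases "r j < k")
    case True
    then have "real (Suc k - Suc (r j)) = real (k - Suc (r j)) + 1" by linarith
    then show ?thesis using True weight_pos[of j]
      by (simp add: iterate_def slope_def field_simps)
  \<comment> \<open>If \<open>r j = k\<close>, the coordinate opens with answer count 0; if
    \<open>r j > k\<close>, it stays 0.\<close>
  qed (auto simp: iterate_def slope_def)
  then show ?thesis by (simp add: vec_eq_iff)
qed

lemma iterate_ge:
  assumes "k \<in> pieces" "r j < k"
  shows "\<eta> / 4 \<le> iterate k $ j"
proof -
  have "real (k - Suc (r j)) / (4 * real (weight j)) \<le> 1 / 4"
    using assms weight_pos[of j] by (auto simp: pieces_def weight_def divide_simps)
  then have "\<eta> * (1 / 4) \<le> \<eta> * (1 / 2 - real (k - Suc (r j)) / (4 * real (weight j)))"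
    using step_nonneg by (intro mult_left_mono) auto
  then show ?thesis using assms by (simp add: iterate_def)
qed

lemma iterate_nonneg: "k \<in> pieces \<Longrightarrow> 0 \<le> iterate k $ j"
  using iterate_ge[of k j] step_nonneg by (cases "r j < k") (auto simp: iterate_def)

lemma iterate_le: "iterate k $ j \<le> \<eta>"
  using mult_left_mono[OF _ step_nonneg, of "1 / 2 - real (k - Suc (r j)) / (4 * real (weight j))" 1]
    step_nonneg
  by (auto simp: iterate_def divide_simps)

lemma norm_iterate:
  assumes "k \<in> pieces"
  shows "norm (iterate k) \<le> 1"
proof -
  have "(norm (iterate k))\<^sup>2 = (\<Sum>j\<in>UNIV. (iterate k $ j)\<^sup>2)"
    by (simp add: norm_vec_def L2_set_def sum_nonneg)
  also have "\<dots> \<le> (\<Sum>j\<in>(UNIV :: 'n set). \<eta>\<^sup>2)"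
    using assms by (intro sum_mono power_mono iterate_le iterate_nonneg)
  also have "\<dots> \<le> 1\<^sup>2" using step_small by simp
  finally show ?thesis by (rule power2_le_imp_le) simp
qed

text \<open>The comparison is coordinatewise: where \<open>r j < k\<close>, the entry of
  \<open>slope k\<close> is the largest that any slope has there; elsewhere the iterate
  vanishes.\<close>

lemma active_iterate:
  assumes "k \<in> pieces"
  shows "active (iterate k) k"
proof -
  have "slope i \<bullet> iterate k \<le> slope k \<bullet> iterate k" for i
    unfolding inner_vec_def inner_real_def
  proof (rule sum_mono)
    fix j
    show "slope i $ j * iterate k $ j \<le> slope k $ j * iterate k $ j"
    proof (cases "r j < k")
      case True
      then have "slope i $ j \<le> slope k $ j"
        by (auto simp: slope_def intro: order_trans[of _ 0])
      then show ?thesis by (rule mult_right_mono) (rule iterate_nonneg[OF assms])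
    qed (simp add: iterate_def)
  qed
  then show ?thesis
    using assms max_linear_eqI[OF finite_pieces assms] by (auto simp: active_def)
qed

section \<open>The oracle and the descent\<close>

lemma subgradient_oracle_answer: "subgradient_oracle X objective (answer m)"
proof -
  have "\<exists>i. active x i" for x
    unfolding active_def by (metis max_linear_attained[OF finite_pieces pieces_nonempty])
  then have "active x (if active x (t - m) then t - m else SOME i. active x i)" for x t
    by (auto intro: someI_ex)
  then have "\<exists>i. active x i \<and> answer m t x = slope i" for x t
    unfolding answer_def by blast
  then show ?thesis
    unfolding subgradient_oracle_def
    by (metis active_def subdifferential_max_linear[OF finite_pieces])
qed

lemma psgd_eq_iterate:
  assumes "X = {x. norm x \<le> 1}" "t \<le> m + CARD('n)"
  shows "psgd X (\<lambda>t. \<eta>) (answer m) 0 (Suc t) = iterate (Suc t - m)"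
  using assms(2)
proof (induction t)
  case 0
  \<comment> \<open>For \<open>m = 0\<close> the index is already 1, but \<open>iterate 1\<close> is
    still the origin because \<open>slope 0 = 0\<close>.\<close>
  show ?case using iterate_Suc[of 0] by (cases m) (auto simp: iterate_0 slope_0)
next
  case (Suc t)
  let ?k = "Suc t - m"
  have k: "?k \<in> pieces" "Suc (Suc t) - m \<in> pieces"
    using Suc.prems by (auto simp: pieces_def)
  have "answer m (Suc t) (iterate ?k) = slope ?k"
    using active_iterate[OF k(1)] by (simp add: answer_def)
  moreover have "iterate ?k - \<eta> *\<^sub>R slope ?k = iterate (Suc (Suc t) - m)"
  proof (cases "m \<le> Suc t")
    case True
    then show ?thesis by (simp add: Suc_diff_le iterate_Suc)
  next
    case False
    then show ?thesis by (simp add: iterate_0 slope_0)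
  qed
  moreover have "iterate (Suc (Suc t) - m) \<in> X"
    using norm_iterate[OF k(2)] assms(1) by simp
  ultimately show ?case
    using Suc by (simp add: closest_point_self)
qed

lemma objective_0: "objective 0 = 0"
  using max_linear_eqI[OF finite_pieces, of 0 slope 0] by (simp add: pieces_def)

lemma is_arg_min_objective: "is_arg_min objective (\<lambda>x. x \<in> X) 0" if "0 \<in> X"
proof -
  have "0 \<le> objective x" for x
    using max_linear_ge[OF finite_pieces, of 0 slope x] by (simp add: pieces_def slope_0)
  then show ?thesis using that by (simp add: is_arg_min_linorder objective_0)
qed

lemma objective_last:
  "\<eta> / 16 * ln (real CARD('n)) \<le> objective (iterate (Suc CARD('n)))"
proof -
  let ?d = "CARD('n)"
  have last: "Suc ?d \<in> pieces" by (simp add: pieces_def)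
  \<comment> \<open>The index \<open>Suc ?d\<close> lies past every position, so the last slope has
    no negative entry.\<close>
  have r_less: "r j < Suc ?d" for j using r_range[of j] by simp
  have "ln (real ?d) \<le> ln (real ?d + 1)" by simp
  also have "\<dots> \<le> harm ?d" by (rule ln_le_harm)
  also have "harm ?d = (\<Sum>j\<in>UNIV. 1 / real (weight j))"
    using sum_weight[of "\<lambda>q. 1 / real q"] by (simp add: harm_def inverse_eq_divide)
  finally have "\<eta> / 16 * ln (real ?d) \<le> \<eta> / 16 * (\<Sum>j\<in>UNIV. 1 / real (weight j))"
    using step_nonneg by (intro mult_left_mono) auto
  also have "\<dots> = (\<Sum>j\<in>UNIV. slope (Suc ?d) $ j * (\<eta> / 4))"
    using r_less by (simp add: sum_distrib_left slope_def)
  also have "\<dots> \<le> slope (Suc ?d) \<bullet> iterate (Suc ?d)"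
    unfolding inner_vec_def inner_real_def using r_less
    by (intro sum_mono mult_left_mono iterate_ge[OF last]) (auto simp: slope_def)
  also have "\<dots> \<le> objective (iterate (Suc ?d))"
    by (rule max_linear_ge[OF finite_pieces last])
  finally show ?thesis .
qed

end

theorem theorem3p11:
  fixes T :: nat and X :: "(real ^ 'n) set"
  assumes "CARD('n) \<le> T"
    and "X = {x. norm x \<le> 1}"
  shows "\<exists>(f :: real ^ 'n \<Rightarrow> real) G.
    convex_on X f \<and> 1-lipschitz_on X f \<and> subgradient_oracle X f G \<and>
    (\<exists>x\<^sub>m\<^sub>i\<^sub>n. is_arg_min f (\<lambda>x. x \<in> X) x\<^sub>m\<^sub>i\<^sub>n \<and>
      f (psgd X (\<lambda>t. 1 / sqrt (real T)) G 0 (T + 1)) - f x\<^sub>m\<^sub>i\<^sub>n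
        \<ge> ln (real CARD('n)) / (32 * sqrt (real T)))"
proof -
  let ?d = "CARD('n)" and ?\<eta> = "1 / sqrt (real T)"
  have d: "1 \<le> ?d" by (simp add: Suc_le_eq)
  obtain r :: "'n \<Rightarrow> nat" where r: "bij_betw r UNIV {1..?d}"
    using finite_same_card_bij[of "UNIV :: 'n set" "{1..?d}"] by auto
  \<comment> \<open>Here \<open>step_small\<close> amounts to
    \<open>CARD('n) / T \<le> 1\<close>.\<close>
  interpret slow_last_iterate r ?\<eta>
    using r assms(1) d by unfold_locales (auto simp: power_divide divide_simps)
  have "convex X"
    using convex_cball[of 0 1] by (simp add: assms(2) cball_def)
  then have "convex_on X objective"
    by (rule convex_on_max_linear[OF finite_pieces pieces_nonempty])
  moreover have "1-lipschitz_on X objective"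
    by (rule lipschitz_on_max_linear[OF finite_pieces pieces_nonempty _ norm_slope]) simp
  moreover have "is_arg_min objective (\<lambda>x. x \<in> X) 0"
    by (rule is_arg_min_objective) (simp add: assms(2))
  moreover have "objective (psgd X (\<lambda>t. ?\<eta>) (answer (T - ?d)) 0 (T + 1)) - objective 0
      \<ge> ln (real ?d) / (32 * sqrt (real T))"
  proof -
    \<comment> \<open>After \<open>T - ?d\<close> idle steps, \<open>?d\<close> answers remain, just
      enough to open every coordinate.\<close>
    have "Suc T - (T - ?d) = Suc ?d" using assms(1) by simp
    then have "psgd X (\<lambda>t. ?\<eta>) (answer (T - ?d)) 0 (T + 1) = iterate (Suc ?d)"
      using psgd_eq_iterate[OF assms(2), of T "T - ?d"] assms(1) by simp
    \<comment> \<open>The construction yields the constant 1/16, twice what is required.\<close>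
    moreover have "ln (real ?d) / (32 * sqrt (real T)) \<le> ?\<eta> / 16 * ln (real ?d)"
    proof -
      have "ln (real ?d) / (32 * sqrt (real T)) = ?\<eta> / 32 * ln (real ?d)" by simp
      also have "\<dots> \<le> ?\<eta> / 16 * ln (real ?d)"
        using d by (intro mult_right_mono divide_left_mono) auto
      finally show ?thesis .
    qed
    ultimately show ?thesis using objective_last objective_0 by simp
  qed
  ultimately show ?thesis using subgradient_oracle_answer by blast
qed

end
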